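(* Let $m\ge 2$ be an integer, let $X$ be a real Hilbert space, and let $R\colon X\to X$ be a linear isometry with $R^m=I_X$. Put $A:=\frac1m\sum_{i=1}^m R^i$, $Y:=\{y\in X: Ay=0\}$ and $S:=R-I_X$. Let $C$ be a nonempty closed convex subset of $X$ with support function $\sigma_C$, and let $P_C$ be the projection of $X$ onto $C$. Let $D:=\{y\in Y:\ \sigma_C(y)+\frac12\|y\|^2\le 0\}$. Let $d,e\in Y$ be such that $d=Se\in D$ and $$\sigma_C(Se)+\langle Sx-Se,e\rangle-\sigma_C(Sx)\le 0\quad\text{for all }x\in X\text{ with }Sx\in D.$$ Let $z\in C$. Then the following conditions are equivalent: (i) $z=P_CRz$; (ii) $z\in S^{-1}D$, i.e. $Sz\in D$; (iii) $z\in S^{-1}d$, i.e. $Sz=d$.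
   Context: All spaces are real. $I_X$ is the identity on $X$. The support function of $C$ is $\sigma_C(t):=\sup_{c\in C}\langle c,t\rangle\in(-\infty,+\infty]$. The projection $P_C$ maps $x\in X$ to the unique point of $C$ nearest to $x$. $S^{-1}D$ and $S^{-1}d$ denote preimages under $S$ (which need not be injective). *)

theory Defs
  imports "HOL-Analysis.Analysis"
begin

text \<open>Hilbert spaces are rendered by the sort \<open>{real_inner, complete_space}\<close>.\<close>

definition support_fun :: "'a::real_inner set \<Rightarrow> 'a \<Rightarrow> ereal"
  where "support_fun C t = (SUP c\<in>C. ereal (inner c t))"

text \<open>The library's \<open>closest_point\<close> requires the Heine-Borel property, so it only covers
  finite-dimensional spaces. For a nonempty closed convex subset of a Hilbert space the
  nearest point exists and is unique.\<close>

definition nearest_point :: "'a::metric_space set \<Rightarrow> 'a \<Rightarrow> 'a"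
  where "nearest_point C x = (THE p. p \<in> C \<and> (\<forall>c\<in>C. dist x p \<le> dist x c))"

end

theory Submission
  imports Defs
begin

text \<open>Since \<open>R\<close> is an isometry, the form \<open>\<langle>u, S v\<rangle> + \<langle>S u, v\<rangle>\<close> equals \<open>-\<langle>S u, S v\<rangle>\<close>; in
  particular \<open>\<langle>z, S z\<rangle> = -\<parallel>S z\<parallel>\<^sup>2/2\<close>. The variational characterisation of the projection therefore
  says that \<open>z = P\<^sub>C (R z)\<close> iff \<open>\<sigma>\<^sub>C (S z) \<le> -\<parallel>S z\<parallel>\<^sup>2/2\<close>, which is membership of \<open>S z\<close> in \<open>D\<close>. If this
  holds, the inequality for \<open>e\<close> at \<open>x = z\<close>, together with \<open>\<langle>z, S e\<rangle> \<le> \<sigma>\<^sub>C (S e)\<close>, reads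
  \<open>\<parallel>S e - S z\<parallel>\<^sup>2 \<le> 0\<close>.\<close>

text \<open>The parallelogram law for \<open>a - x\<close> and \<open>a - y\<close>. It turns a
  lower bound on the distance from \<open>a\<close> to the midpoint into an upper bound on
  \<open>dist x y\<close>, which serves both existence and uniqueness of the nearest point.\<close>

lemma midpoint_dist_square:
  fixes a x y :: "'a::real_inner"
  shows "(dist x y)\<^sup>2 = 2 * (dist a x)\<^sup>2 + 2 * (dist a y)\<^sup>2 - 4 * (dist a ((1/2) *\<^sub>R x + (1/2) *\<^sub>R y))\<^sup>2"
  unfolding dist_norm power2_norm_eq_inner
  by (simp add: inner_commute algebra_simps)

text \<open>The near-minimisers \<open>F n\<close> form a decreasing sequence of nonempty closed
  sets. Convexity keeps midpoints in \<open>C\<close>, so \<open>midpoint_dist_square\<close> forces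
  their diameters to 0, and completeness yields a common point, which attains the infimum
  \<open>r\<close>.\<close>

lemma nearest_exists:
  fixes C :: "'a::{real_inner, complete_space} set"
  assumes "C \<noteq> {}" "closed C" "convex C"
  shows "\<exists>p\<in>C. \<forall>c\<in>C. dist a p \<le> dist a c"
proof -
  define r where "r = (INF c\<in>C. (dist a c)\<^sup>2)"
  define F where "F n = C \<inter> {c. (dist a c)\<^sup>2 \<le> r + inverse (real (Suc n))}" for n
  have bdd: "bdd_below ((\<lambda>c. (dist a c)\<^sup>2) ` C)"
    by (rule bdd_belowI2[of _ 0]) auto
  have r_le: "r \<le> (dist a c)\<^sup>2" if "c \<in> C" for c
    unfolding r_def using bdd that by (rule cINF_lower)
  have "\<exists>p. \<forall>n. p \<in> F n"
  proof (rule decreasing_closed_nest[of F])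
    show "closed (F n)" for n
      unfolding F_def using assms(2)
      by (intro closed_Int closed_Collect_le continuous_intros)
    show "F n \<noteq> {}" for n
    proof -
      have "r < r + inverse (real (Suc n))" by simp
      then obtain c where "c \<in> C" "(dist a c)\<^sup>2 < r + inverse (real (Suc n))"
        unfolding r_def using cINF_less_iff[OF assms(1) bdd] by metis
      then have "c \<in> F n" unfolding F_def by simp
      then show ?thesis by blast
    qed
    show "F n \<subseteq> F k" if "k \<le> n" for k n
    proof -
      have "inverse (real (Suc n)) \<le> inverse (real (Suc k))"
        using that by (intro le_imp_inverse_le) auto
      then show ?thesis unfolding F_def by (smt (verit) Int_iff mem_Collect_eq subsetI)
    qed
    show "\<exists>n. \<forall>x\<in>F n. \<forall>y\<in>F n. dist x y < \<epsilon>" if "\<epsilon> > 0" for \<epsilon>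
    proof -
      \<comment> \<open>With \<delta> = \<open>inverse (real (Suc n))\<close>, the squared distance
        of two points of \<open>F n\<close> is at most 4(r + \<delta>) - 4r = 4\<delta>; hence the
        quarter.\<close>
      obtain n where n: "inverse (real (Suc n)) < \<epsilon>\<^sup>2 / 4"
        using reals_Archimedean[of "\<epsilon>\<^sup>2 / 4"] \<open>\<epsilon> > 0\<close> by auto
      have "dist x y < \<epsilon>" if x: "x \<in> F n" and y: "y \<in> F n" for x y
      proof -
        have "(1/2) *\<^sub>R x + (1/2) *\<^sub>R y \<in> C"
          using x y \<open>convex C\<close> unfolding F_def by (intro convexD) auto
        then have "r \<le> (dist a ((1/2) *\<^sub>R x + (1/2) *\<^sub>R y))\<^sup>2" by (rule r_le)
        moreover have "(dist a x)\<^sup>2 \<le> r + inverse (real (Suc n))"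
          "(dist a y)\<^sup>2 \<le> r + inverse (real (Suc n))"
          using x y unfolding F_def by auto
        ultimately have "(dist x y)\<^sup>2 < \<epsilon>\<^sup>2"
          unfolding midpoint_dist_square[of x y a] using n by linarith
        then show ?thesis using \<open>\<epsilon> > 0\<close> by (simp add: power2_less_imp_less)
      qed
      then show ?thesis by blast
    qed
  qed blast
  then obtain p where p: "p \<in> F n" for n by blast
  have "(dist a p)\<^sup>2 \<le> r"
  proof (rule field_le_epsilon)
    fix \<epsilon> :: real assume "\<epsilon> > 0"
    then obtain n where "inverse (real (Suc n)) < \<epsilon>" using reals_Archimedean by blast
    then show "(dist a p)\<^sup>2 \<le> r + \<epsilon>" using p[of n] unfolding F_def by simp
  qed
  then have "dist a p \<le> dist a c" if "c \<in> C" for c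
    using r_le[OF that] by (meson order_trans power2_le_imp_le zero_le_dist)
  moreover have "p \<in> C" using p unfolding F_def by simp
  ultimately show ?thesis by blast
qed

text \<open>The midpoint of two nearest points is no closer to \<open>a\<close> than either of them,
  so the parallelogram law leaves no distance between them.\<close>

lemma nearest_unique:
  fixes C :: "'a::real_inner set"
  assumes "convex C" "p \<in> C" "q \<in> C"
    and p: "\<forall>c\<in>C. dist a p \<le> dist a c" and q: "\<forall>c\<in>C. dist a q \<le> dist a c"
  shows "p = q"
proof -
  let ?w = "(1/2) *\<^sub>R p + (1/2) *\<^sub>R q"
  have "?w \<in> C" using assms(1-3) by (intro convexD) auto
  then have "(dist a p)\<^sup>2 \<le> (dist a ?w)\<^sup>2" "(dist a q)\<^sup>2 \<le> (dist a ?w)\<^sup>2"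
    using p q by (auto intro!: power_mono)
  then have "(dist p q)\<^sup>2 \<le> 0"
    using midpoint_dist_square[of p q a] by linarith
  then show ?thesis by simp
qed

lemma nearest_point_eq_iff:
  fixes C :: "'a::{real_inner, complete_space} set"
  assumes "C \<noteq> {}" "closed C" "convex C"
  shows "z = nearest_point C x \<longleftrightarrow> z \<in> C \<and> (\<forall>c\<in>C. dist x z \<le> dist x c)"
proof -
  have "\<exists>!p. p \<in> C \<and> (\<forall>c\<in>C. dist x p \<le> dist x c)"
    using nearest_exists[OF assms, of x] nearest_unique[OF assms(3)] by blast
  from theI'[OF this] this show ?thesis
    unfolding nearest_point_def by blast
qed

text \<open>Along the segment from \<open>z\<close> to \<open>c\<close> the squared distance to
  \<open>x\<close> is a quadratic in \<open>t\<close>. Minimality at \<open>t = 0\<close> makes its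
  linear coefficient nonnegative; conversely, evaluate the quadratic at
  \<open>t = 1\<close>.\<close>

lemma nearest_iff_inner_le:
  fixes C :: "'a::real_inner set"
  assumes "convex C" "z \<in> C"
  shows "(\<forall>c\<in>C. dist x z \<le> dist x c) \<longleftrightarrow> (\<forall>c\<in>C. inner (c - z) (x - z) \<le> 0)"
proof -
  have expand: "(dist x (z + t *\<^sub>R (c - z)))\<^sup>2 =
      (dist x z)\<^sup>2 - 2 * t * inner (c - z) (x - z) + t\<^sup>2 * (norm (c - z))\<^sup>2" for t c
    unfolding dist_norm power2_norm_eq_inner
    by (simp add: inner_commute algebra_simps power2_eq_square)
  show ?thesis
  proof (intro iffI ballI)
    fix c assume near: "\<forall>c\<in>C. dist x z \<le> dist x c" and c: "c \<in> C"
    have "2 * inner (c - z) (x - z) \<le> t * (norm (c - z))\<^sup>2" if t: "0 < t" "t < 1" for t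
    proof -
      have "z + t *\<^sub>R (c - z) = (1 - t) *\<^sub>R z + t *\<^sub>R c" by (simp add: algebra_simps)
      also have "\<dots> \<in> C" using assms c t by (intro convexD) auto
      finally have "(dist x z)\<^sup>2 \<le> (dist x (z + t *\<^sub>R (c - z)))\<^sup>2"
        using near by (intro power_mono) auto
      then have "t * (2 * inner (c - z) (x - z)) \<le> t * (t * (norm (c - z))\<^sup>2)"
        unfolding expand by (simp add: power2_eq_square mult_ac)
      then show ?thesis using t by simp
    qed
    \<comment> \<open>After division by \<open>t\<close>, letting \<open>t\<close> tend to 0 from
      the right removes the quadratic term.\<close>
    then have "\<forall>\<^sub>F t in at_right 0. 2 * inner (c - z) (x - z) \<le> t * (norm (c - z))\<^sup>2"
      using eventually_at_right_real[of 0 1] by (auto elim: eventually_mono)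
    moreover have "((\<lambda>t. t * (norm (c - z))\<^sup>2) \<longlongrightarrow> 0 * (norm (c - z))\<^sup>2) (at_right 0)"
      by (intro tendsto_intros)
    ultimately have "2 * inner (c - z) (x - z) \<le> 0 * (norm (c - z))\<^sup>2"
      by (intro tendsto_lowerbound) auto
    then show "inner (c - z) (x - z) \<le> 0" by simp
  next
    fix c assume "\<forall>c\<in>C. inner (c - z) (x - z) \<le> 0" and "c \<in> C"
    then have "inner (c - z) (x - z) \<le> 0" by blast
    then have "(dist x z)\<^sup>2 \<le> (dist x z)\<^sup>2 - 2 * inner (c - z) (x - z) + (norm (c - z))\<^sup>2"
      using zero_le_power2[of "norm (c - z)"] by linarith
    also have "\<dots> = (dist x c)\<^sup>2"
      using expand[of 1 c] by simp
    finally have "(dist x z)\<^sup>2 \<le> (dist x c)\<^sup>2" .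
    then show "dist x z \<le> dist x c" by (rule power2_le_imp_le) simp
  qed
qed

text \<open>Polarization: norms of \<open>u\<close>, \<open>v\<close> and \<open>u + v\<close>
  determine the inner product.\<close>

lemma isometry_inner:
  fixes R :: "'a::real_inner \<Rightarrow> 'a"
  assumes "linear R" "\<forall>x. norm (R x) = norm x"
  shows "inner (R u) (R v) = inner u v"
proof -
  have "(norm (R (u + v)))\<^sup>2 = (norm (u + v))\<^sup>2" "(norm (R u))\<^sup>2 = (norm u)\<^sup>2" "(norm (R v))\<^sup>2 = (norm v)\<^sup>2"
    using assms(2) by simp_all
  then show ?thesis
    unfolding linear_add[OF assms(1)] power2_norm_eq_inner
    by (simp add: inner_add inner_commute)
qed

lemma isometry_displacement_inner:
  fixes R :: "'a::real_inner \<Rightarrow> 'a"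
  assumes "linear R" "\<forall>x. norm (R x) = norm x"
  shows "inner u (R v - v) + inner (R u - u) v = - inner (R u - u) (R v - v)"
  using isometry_inner[OF assms, of u v]
  by (simp add: inner_diff_left inner_diff_right)

lemma support_fun_le_iff:
  "support_fun C t \<le> ereal r \<longleftrightarrow> (\<forall>c\<in>C. inner c t \<le> r)"
  unfolding support_fun_def by (simp add: SUP_le_iff)

lemma inner_le_support_fun:
  "c \<in> C \<Longrightarrow> ereal (inner c t) \<le> support_fun C t"
  unfolding support_fun_def by (rule SUP_upper)

text \<open>The sum telescopes to \<open>R ((R ^^ m) x) - R x\<close>, up to the order of
  composition. Consequently every displacement \<open>R x - x\<close> lies in the kernel of the
  average \<open>A\<close>.\<close>

lemma sum_powers_displacement:
  fixes R :: "'a::real_vector \<Rightarrow> 'a"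
  assumes "linear R" "R ^^ m = id"
  shows "(\<Sum>i=1..m. (R ^^ i) (R x - x)) = 0"
proof -
  have "linear (R ^^ i)" for i
  proof (induction i)
    case 0
    show ?case using linear_id by (simp add: id_def)
  next
    case (Suc i)
    then show ?case unfolding funpow.simps by (rule linear_compose) (rule assms(1))
  qed
  then have "(R ^^ i) (R x - x) = (R ^^ Suc i) x - (R ^^ i) x" for i
    unfolding funpow_Suc_right comp_apply by (rule linear_diff)
  then have "(\<Sum>i=1..m. (R ^^ i) (R x - x)) = (\<Sum>i=1..m. (R ^^ Suc i) x - (R ^^ i) x)"
    by (rule sum.cong[OF refl])
  also have "\<dots> = (R ^^ Suc m) x - (R ^^ 1) x"
    by (rule sum_Suc_diff) simp
  also have "\<dots> = 0" using assms(2) by simp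
  finally show ?thesis .
qed

theorem theorem7:
  fixes m :: nat
    and R A S :: "'a::{real_inner, complete_space} \<Rightarrow> 'a"
    and Y C D :: "'a set"
    and d e z :: 'a
  assumes "m \<ge> 2"
    and "linear R" and "\<forall>x. norm (R x) = norm x" and "R ^^ m = id"
    and "A = (\<lambda>x. (1 / real m) *\<^sub>R (\<Sum>i=1..m. (R ^^ i) x))"
    and "Y = {y. A y = 0}"
    and "S = (\<lambda>x. R x - x)"
    and "C \<noteq> {}" and "closed C" and "convex C"
    and "D = {y \<in> Y. support_fun C y + ereal (1 / 2 * (norm y)\<^sup>2) \<le> 0}"
    and "d \<in> Y" and "e \<in> Y" and "d = S e" and "d \<in> D"
    and "\<forall>x. S x \<in> D \<longrightarrow>
           support_fun C (S e) + ereal (inner (S x - S e) e) - support_fun C (S x) \<le> 0"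
    and "z \<in> C"
  shows "(z = nearest_point C (R z) \<longleftrightarrow> z \<in> S -` D)
       \<and> (z \<in> S -` D \<longleftrightarrow> z \<in> S -` {d})"
proof -
  note R = assms(2,3)
  have inner_S: "inner x (S y) + inner (S x) y = - inner (S x) (S y)" for x y
    unfolding \<open>S = _\<close> by (rule isometry_displacement_inner[OF R])
  have inner_self: "inner z (S z) = - (norm (S z))\<^sup>2 / 2"
    using inner_S[of z z] by (simp add: inner_commute power2_norm_eq_inner)
  have "S z \<in> Y"
    using sum_powers_displacement[OF assms(2,4), of z] unfolding \<open>Y = _\<close> \<open>A = _\<close> \<open>S = _\<close> by simp
  moreover have shift: "t + ereal a \<le> 0 \<longleftrightarrow> t \<le> ereal (- a)" for t a
    by (cases t) auto
  \<comment> \<open>Membership in \<open>Y\<close> is automatic for \<open>S z\<close>, so only the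
    inequality in \<open>D\<close> remains, and its bound is the value of the linear functional at
    \<open>z\<close> itself.\<close>
  ultimately have Sz_D: "S z \<in> D \<longleftrightarrow> support_fun C (S z) \<le> ereal (inner z (S z))"
    unfolding \<open>D = _\<close> inner_self by simp
  have "z = nearest_point C (R z) \<longleftrightarrow> (\<forall>c\<in>C. inner (c - z) (S z) \<le> 0)"
    using nearest_point_eq_iff[OF assms(8-10)] nearest_iff_inner_le[OF assms(10) \<open>z \<in> C\<close>] \<open>z \<in> C\<close>
    unfolding \<open>S = _\<close> by blast
  also have "\<dots> \<longleftrightarrow> S z \<in> D"
    unfolding Sz_D support_fun_le_iff by (simp add: inner_diff_left)
  finally have i_ii: "z = nearest_point C (R z) \<longleftrightarrow> S z \<in> D" .
  have "S z = d" if "S z \<in> D"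
  proof -
    \<comment> \<open>As \<open>z\<close> lies in \<open>C\<close>, the upper bound from
      \<open>D\<close> is attained at \<open>z\<close>; the supremum is thus finite and known
      exactly.\<close>
    have \<sigma>z: "support_fun C (S z) = ereal (inner z (S z))"
      using that Sz_D inner_le_support_fun[OF \<open>z \<in> C\<close>] by (blast intro: order_antisym)
    have "support_fun C (S e) \<le> ereal (- ((norm (S e))\<^sup>2 / 2))"
      using \<open>d \<in> D\<close> unfolding \<open>d = S e\<close> \<open>D = _\<close> by (simp add: shift)
    moreover have "ereal (inner z (S e)) \<le> support_fun C (S e)"
      by (rule inner_le_support_fun[OF \<open>z \<in> C\<close>])
    \<comment> \<open>Bounded above through \<open>d \<in> D\<close> and below through
      \<open>z \<in> C\<close>, the support function is finite at \<open>S e\<close>, so the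
      extended-real hypothesis becomes a real inequality.\<close>
    ultimately obtain s where s: "support_fun C (S e) = ereal s" "inner z (S e) \<le> s"
      by (cases "support_fun C (S e)") auto
    have "support_fun C (S e) + ereal (inner (S z - S e) e) - support_fun C (S z) \<le> 0"
      using assms(16) that by blast
    then have "s + inner (S z - S e) e - inner z (S z) \<le> 0"
      unfolding s \<sigma>z by simp
    moreover have "inner (S e) e = - (norm (S e))\<^sup>2 / 2"
      using inner_S[of e e] by (simp add: inner_commute power2_norm_eq_inner)
    \<comment> \<open>Replace \<open>s\<close> by the smaller \<open>inner z (S e)\<close>; since
      \<open>inner z (S e) + inner (S z) e = - inner (S z) (S e)\<close>, the left side becomes half
      of the squared norm.\<close>
    ultimately have "(norm (S z - S e))\<^sup>2 \<le> 0"
      using s(2) inner_S[of z e] inner_self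
      by (simp add: power2_norm_eq_inner inner_diff_left inner_diff_right inner_commute)
    then show ?thesis unfolding \<open>d = S e\<close> by simp
  qed
  then show ?thesis using i_ii \<open>d \<in> D\<close> by auto
qed

end
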